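(* Let $l:\mathbb{N}\to\mathbb{N}$ and $\rho:\mathbb{N}\to\mathbb{N}$ be functions such that $\rho(n)\le n$ for every $n\in\mathbb{N}$, $n^2=o(l(n))$ as $n\to\infty$, and $l(n)\le \binom{n}{3}$ for every $n\in\mathbb{N}$. Then for every $W\subset V_n$ with $|W|=l(n)$, $$r_\rho(W)\ \ge\ \frac{l(n)^2}{n}\left(2-\frac{\rho(n)^3}{6\,l(n)}+o(1)\right)\qquad (n\to\infty),$$ where the $o(1)$ term is a function of $n$ tending to $0$ that does not depend on the choice of $W$.
   Context: Graph. For $n\in\mathbb{N}$ let $\mathcal{R}_n=\{1,\dots,n\}$. The graph $G_n=G(n,3,1)=(V_n,E_n)$ has as vertex set $V_n$ the set of all 3-element subsets of $\mathcal{R}_n$ (equivalently, all $0/1$-vectors of length $n$ with exactly three ones). Two vertices are joined by an edge if and only if the corresponding 3-element subsets have exactly one common element (equivalently, the scalar product of the vectors equals $1$). Thus $|V_n|=\binom n3$ and $|E_n|=\frac32\binom{n-3}{2}\binom n3$. Number of edges. For $W\subseteq V_n$, $r(W)$ is the number of edges of $G_n$ with both endpoints in $W$. Types of vertex sets. The support of a set of vertices is the union (as subsets of $\mathcal{R}_n$) of all its vertices. A set $W\subseteq V_n$ is - of the first type if $|W|\ge 3$ and there are distinct $i,j\in\mathcal{R}_n$ with $i,j\in w$ for every $w\in W$; - of the second type if $|W|\ge 2$ and there are $i,j,k,t\in\mathcal{R}_n$ with $w\subset\{i,j,k,t\}$ for every $w\in W$; - of the third type if $w_1\cap w_2=\emptyset$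 for all distinct $w_1,w_2\in W$. Every independent set of $G_n$ is a union of sets of the first, second and third types whose supports are pairwise disjoint. Star sets and diameter. A star set is an independent set of $G_n$ consisting of vertices belonging to sets of the first and third types in such a decomposition, i.e. an independent set that is a union of sets of the first and third types with pairwise disjoint supports. The diameter $d(A)$ of a star set $A$ is the cardinality of its support. The diameter of a set of vertices $W\subseteq V_n$ is $d(W)=\max\{d(A) : A\subset W,\ A \text{ is a star set}\}$ (here $A=W$ is allowed). The function $r_\rho$. For $\rho:\mathbb{N}\to\mathbb{N}$ with $\rho(n)\le n$ for all $n$, and $W\subset V_n$, put $r_\rho(W)=r(W)$ if $d(W)\le\rho(n)$, and $r_\rho(W)=|E_n|$ (the total number of edges of $G_n$) if $d(W)>\rho(n)$. The inclusion $W\subset V_n$ is not required to be strict. *)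

theory Defs
  imports Complex_Main "HOL-Library.Landau_Symbols" "HOL-Library.Disjoint_Sets"
begin

text \<open>The graph \<open>G(n,3,1)\<close>: its vertices are the 3-element subsets of \<open>{1,\<dots>,n}\<close>.\<close>

definition ground :: "nat \<Rightarrow> nat set" where
  "ground n = {1..n}"

definition verts :: "nat \<Rightarrow> nat set set" where
  "verts n = {v. v \<subseteq> ground n \<and> card v = 3}"

text \<open>There are no loops, since \<open>card (u \<inter> u) = 3\<close> for a vertex \<open>u\<close>.\<close>

definition adj :: "nat set \<Rightarrow> nat set \<Rightarrow> bool" where
  "adj u v \<longleftrightarrow> card (u \<inter> v) = 1"

definition edges :: "nat \<Rightarrow> nat set set set" where
  "edges n = {{u, v} | u v. u \<in> verts n \<and> v \<in> verts n \<and> adj u v}"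

definition num_edges :: "nat \<Rightarrow> nat set set \<Rightarrow> nat" where
  "num_edges n W = card {e \<in> edges n. e \<subseteq> W}"

definition independent :: "nat \<Rightarrow> nat set set \<Rightarrow> bool" where
  "independent n A \<longleftrightarrow> A \<subseteq> verts n \<and> (\<forall>u\<in>A. \<forall>v\<in>A. \<not> adj u v)"

definition support :: "nat set set \<Rightarrow> nat set" where
  "support W = \<Union> W"

definition first_type :: "nat \<Rightarrow> nat set set \<Rightarrow> bool" where
  "first_type n W \<longleftrightarrow> W \<subseteq> verts n \<and> card W \<ge> 3 \<and>
     (\<exists>i\<in>ground n. \<exists>j\<in>ground n. i \<noteq> j \<and> (\<forall>w\<in>W. i \<in> w \<and> j \<in> w))"

definition third_type :: "nat \<Rightarrow> nat set set \<Rightarrow> bool" where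
  "third_type n W \<longleftrightarrow> W \<subseteq> verts n \<and> disjoint W"

definition star_set :: "nat \<Rightarrow> nat set set \<Rightarrow> bool" where
  "star_set n A \<longleftrightarrow> independent n A \<and>
     (\<exists>F. A = \<Union> F \<and> (\<forall>U\<in>F. first_type n U \<or> third_type n U) \<and>
          disjoint_family_on support F)"

definition star_diameter :: "nat set set \<Rightarrow> nat" where
  "star_diameter A = card (support A)"

definition vset_diameter :: "nat \<Rightarrow> nat set set \<Rightarrow> nat" where
  "vset_diameter n W = Max {star_diameter A | A. A \<subseteq> W \<and> star_set n A}"

text \<open>The maximum is over a finite nonempty set: the empty set is a star set.\<close>

lemma finite_verts: "finite (verts n)"
  by (rule finite_subset[of _ "Pow (ground n)"]) (auto simp: verts_def ground_def)

lemma vset_diameter_wf: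
  assumes "W \<subseteq> verts n"
  shows "finite {star_diameter A | A. A \<subseteq> W \<and> star_set n A}"
    and "{star_diameter A | A. A \<subseteq> W \<and> star_set n A} \<noteq> {}"
proof -
  have "finite W"
    using assms finite_verts finite_subset by blast
  then have "finite (star_diameter ` Pow W)"
    by simp
  then show "finite {star_diameter A | A. A \<subseteq> W \<and> star_set n A}"
    by (rule rev_finite_subset) auto
  have "star_set n {}"
    unfolding star_set_def independent_def
    by (intro conjI exI[of _ "{}"]) (auto simp: disjoint_family_on_def)
  then show "{star_diameter A | A. A \<subseteq> W \<and> star_set n A} \<noteq> {}"
    by blast
qed

definition r_bounded :: "(nat \<Rightarrow> nat) \<Rightarrow> nat \<Rightarrow> nat set set \<Rightarrow> nat" where
  "r_bounded \<rho> n W =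
     (if vset_diameter n W \<le> \<rho> n then num_edges n W else card (edges n))"

end

theory Submission
  imports Defs "HOL-Analysis.Convex"
begin

text \<open>Write \<open>d i\<close> for the number of members of \<open>W\<close> containing \<open>i\<close>. Double counting turns
  \<open>\<Sum>i. (d i)\<^sup>2\<close> into \<open>\<Sum>u v. card (u \<inter> v)\<close>. By Cauchy--Schwarz the former is at least
  \<open>(3l)\<^sup>2 / n\<close>. In the latter, adjacent pairs contribute twice the number of edges, and at most
  \<open>3n\<close> vertices \<open>v\<close> meet a given \<open>u\<close> in two or more points, so all other pairs contribute at
  most \<open>9nl\<close>, which is negligible against \<open>l\<^sup>2 / n\<close> because \<open>n\<^sup>2 = o(l)\<close>. This yields
  the constant \<open>9/2\<close> in place of \<open>2\<close>, whatever the diameter of \<open>W\<close>.\<close>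

lemma finite_vert: "v \<in> verts n \<Longrightarrow> finite v"
  by (auto simp: verts_def ground_def intro: finite_subset)

lemma card_vert: "v \<in> verts n \<Longrightarrow> card v = 3"
  by (simp add: verts_def)

text \<open>Such a \<open>v\<close> shares a two-point set with \<open>u\<close>, so it arises from
  \<open>u\<close> by replacing one point \<open>a\<close> by some \<open>x\<close> (with
  \<open>x = a\<close> when \<open>v = u\<close>): three choices for \<open>a\<close> and
  \<open>n\<close> for \<open>x\<close>.\<close>

lemma card_verts_meeting_twice_le:
  assumes u: "u \<in> verts n"
  shows "card {v \<in> verts n. card (u \<inter> v) \<ge> 2} \<le> 3 * n"
proof -
  have fin: "finite u" and cu: "card u = 3"
    using u finite_vert card_vert by auto
  have "{v \<in> verts n. card (u \<inter> v) \<ge> 2} \<subseteq> (\<lambda>(a, x). insert x (u - {a})) ` (u \<times> ground n)"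
  proof
    fix v assume "v \<in> {v \<in> verts n. card (u \<inter> v) \<ge> 2}"
    then have v: "v \<in> verts n" and two: "2 \<le> card (u \<inter> v)"
      by auto
    obtain p where p: "p \<subseteq> u \<inter> v" "card p = 2"
      using two by (meson obtain_subset_with_card_n)
    have finp: "finite p"
      using p(2) card.infinite by fastforce
    have "card (u - p) = 1" "card (v - p) = 1"
      using p cu card_vert[OF v] finp by (simp_all add: card_Diff_subset)
    then obtain a x where "u - p = {a}" "v - p = {x}"
      by (meson card_1_singletonE)
    then have "v = insert x (u - {a})" "a \<in> u" "x \<in> ground n"
      using p(1) v by (auto simp: verts_def)
    then show "v \<in> (\<lambda>(a, x). insert x (u - {a})) ` (u \<times> ground n)"
      by force
  qed
  then have "card {v \<in> verts n. card (u \<inter> v) \<ge> 2} \<le> card (u \<times> ground n)"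
    using fin by (intro surj_card_le) (auto simp: ground_def)
  then show ?thesis
    by (simp add: card_cartesian_product cu ground_def)
qed

lemma finite_edges: "finite (edges n)"
  by (rule finite_subset[of _ "Pow (verts n)"]) (auto simp: edges_def finite_verts)

lemma num_edges_le: "num_edges n W \<le> card (edges n)"
  unfolding num_edges_def by (intro card_mono finite_edges) auto

text \<open>Here the diameter drops out: the other branch of \<open>r_bounded\<close> is the total
  number of edges, which bounds \<open>num_edges\<close> for any \<open>W\<close>.\<close>

lemma num_edges_le_r_bounded: "num_edges n W \<le> r_bounded \<rho> n W"
  using num_edges_le by (simp add: r_bounded_def)

text \<open>Sending \<open>(u, v)\<close> to \<open>{u, v}\<close> lands in the edges inside
  \<open>W\<close>, and each fiber holds at most the two orderings of an edge.\<close>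

lemma card_adj_pairs_le:
  assumes W: "W \<subseteq> verts n"
  shows "card {(u, v) \<in> W \<times> W. adj u v} \<le> 2 * num_edges n W"
proof -
  let ?E = "{e \<in> edges n. e \<subseteq> W}"
  let ?fib = "\<lambda>e. {(u, v). {u, v} = e}"
  have fib: "finite (?fib e) \<and> card (?fib e) \<le> 2" if e: "e \<in> ?E" for e
  proof -
    obtain a b where "e = {a, b}"
      using e by (auto simp: edges_def)
    then have sub: "?fib e \<subseteq> {(a, b), (b, a)}"
      by (auto simp: doubleton_eq_iff)
    have "card (?fib e) \<le> card {(a, b), (b, a)}"
      by (rule card_mono[OF _ sub]) simp
    also have "\<dots> \<le> 2"
      by (cases "a = b") simp_all
    finally show ?thesis
      using finite_subset[OF sub] by simp
  qed
  have finE: "finite ?E"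
    by (simp add: finite_edges)
  have "{(u, v) \<in> W \<times> W. adj u v} \<subseteq> (\<Union>e\<in>?E. ?fib e)"
    using W by (auto simp: edges_def)
  then have "card {(u, v) \<in> W \<times> W. adj u v} \<le> card (\<Union>e\<in>?E. ?fib e)"
    using finE fib by (intro card_mono) auto
  also have "\<dots> \<le> (\<Sum>e\<in>?E. card (?fib e))"
    by (rule card_UN_le[OF finE])
  also have "\<dots> \<le> (\<Sum>e\<in>?E. 2)"
    using fib by (intro sum_mono) auto
  finally show ?thesis
    by (simp add: num_edges_def)
qed

lemma sum_card_inter_le:
  assumes W: "W \<subseteq> verts n"
  shows "(\<Sum>u\<in>W. \<Sum>v\<in>W. card (u \<inter> v)) \<le> 2 * num_edges n W + 9 * n * card W"
proof -
  have finW: "finite W"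
    using W finite_verts finite_subset by blast
  have inner: "(\<Sum>v\<in>W. card (u \<inter> v)) \<le> card {v \<in> W. adj u v} + 9 * n" if u: "u \<in> W" for u
  proof -
    have uv: "u \<in> verts n"
      using u W by auto
    have le3: "card (u \<inter> v) \<le> 3" for v
      by (metis card_mono card_vert finite_vert inf_le1 uv)
    \<comment> \<open>Disjoint pairs contribute 0, adjacent ones 1, and the rest,
      \<open>v = u\<close> among them, at most 3 each; there are at most \<open>3 * n\<close> of the
      last kind, whence \<open>9 * n\<close>.\<close>
    have "(\<Sum>v\<in>W. card (u \<inter> v)) \<le> (\<Sum>v\<in>W. of_bool (adj u v) + 3 * of_bool (card (u \<inter> v) \<ge> 2))"
      using le3 by (intro sum_mono) (auto simp: adj_def of_bool_def)
    also have "\<dots> = card {v \<in> W. adj u v} + 3 * card {v \<in> W. card (u \<inter> v) \<ge> 2}"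
      using finW by (simp add: sum.distrib Collect_conj_eq flip: sum_distrib_left)
    also have "card {v \<in> W. card (u \<inter> v) \<ge> 2} \<le> card {v \<in> verts n. card (u \<inter> v) \<ge> 2}"
      using W by (intro card_mono) (auto simp: finite_verts)
    also have "\<dots> \<le> 3 * n"
      by (rule card_verts_meeting_twice_le[OF uv])
    finally show ?thesis
      by simp
  qed
  have "{(u, v) \<in> W \<times> W. adj u v} = (SIGMA u:W. {v \<in> W. adj u v})"
    by auto
  then have pairs: "card {(u, v) \<in> W \<times> W. adj u v} = (\<Sum>u\<in>W. card {v \<in> W. adj u v})"
    using finW by simp
  have "(\<Sum>u\<in>W. \<Sum>v\<in>W. card (u \<inter> v)) \<le> (\<Sum>u\<in>W. card {v \<in> W. adj u v} + 9 * n)"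
    by (rule sum_mono[OF inner])
  also have "\<dots> = card {(u, v) \<in> W \<times> W. adj u v} + 9 * n * card W"
    by (simp only: sum.distrib pairs) simp
  finally show ?thesis
    using card_adj_pairs_le[OF W] by simp
qed

text \<open>Cauchy--Schwarz for the degrees, cleared of the denominator \<open>n\<close> and of
  subtraction so that it can be stated over \<open>nat\<close>, also for
  \<open>n = 0\<close>.\<close>

lemma num_edges_lower_bound:
  assumes W: "W \<subseteq> verts n"
  shows "9 * card W ^ 2 \<le> n * (2 * num_edges n W + 9 * n * card W)"
proof -
  \<comment> \<open>A sum of indicators instead of a cardinality, so that sums can be exchanged and
    squares expanded.\<close>
  define d where "d i = (\<Sum>w\<in>W. of_bool (i \<in> w) :: nat)" for i
  have card_sum: "card (u \<inter> v) = (\<Sum>i\<in>ground n. of_bool (i \<in> u) * of_bool (i \<in> v))"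
    if "u \<in> W" for u v
  proof -
    have "u \<inter> v = ground n \<inter> {i. i \<in> u \<and> i \<in> v}"
      using that W by (auto simp: verts_def)
    then show ?thesis
      by (simp add: ground_def flip: of_bool_conj)
  qed
  have "(\<Sum>i\<in>ground n. d i) = (\<Sum>w\<in>W. \<Sum>i\<in>ground n. of_bool (i \<in> w))"
    unfolding d_def by (rule sum.swap)
  \<comment> \<open>The form \<open>w \<inter> w\<close> lets \<open>card_sum\<close> serve here
    too, since the square of an indicator is the indicator itself.\<close>
  also have "\<dots> = (\<Sum>w\<in>W. card (w \<inter> w))"
    by (intro sum.cong refl, subst card_sum) (auto intro!: sum.cong)
  also have "\<dots> = 3 * card W"
  proof -
    have "(\<Sum>w\<in>W. card (w \<inter> w)) = (\<Sum>w\<in>W. 3)"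
      using W card_vert by (intro sum.cong) auto
    then show ?thesis
      by simp
  qed
  finally have total: "(\<Sum>i\<in>ground n. d i) = 3 * card W" .
  have "(\<Sum>i\<in>ground n. d i ^ 2)
      = (\<Sum>i\<in>ground n. \<Sum>u\<in>W. \<Sum>v\<in>W. of_bool (i \<in> u) * of_bool (i \<in> v))"
    by (simp only: d_def power2_eq_square sum_product)
  also have "\<dots> = (\<Sum>u\<in>W. \<Sum>v\<in>W. \<Sum>i\<in>ground n. of_bool (i \<in> u) * of_bool (i \<in> v))"
    by (subst sum.swap, intro sum.cong refl, rule sum.swap)
  also have "\<dots> = (\<Sum>u\<in>W. \<Sum>v\<in>W. card (u \<inter> v))"
    by (intro sum.cong refl) (simp only: card_sum)
  finally have squares: "(\<Sum>i\<in>ground n. d i ^ 2) = (\<Sum>u\<in>W. \<Sum>v\<in>W. card (u \<inter> v))" .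
  have "real ((\<Sum>i\<in>ground n. d i) ^ 2) \<le> real ((\<Sum>i\<in>ground n. d i ^ 2) * n)"
    using sum_squared_le_sum_of_squares[of "\<lambda>i. real (d i)" "ground n"] by (simp add: ground_def)
  then have "(\<Sum>i\<in>ground n. d i) ^ 2 \<le> (\<Sum>i\<in>ground n. d i ^ 2) * n"
    by (simp only: of_nat_le_iff)
  also have "\<dots> \<le> (2 * num_edges n W + 9 * n * card W) * n"
    unfolding squares by (intro mult_right_mono sum_card_inter_le[OF W]) simp
  finally show ?thesis
    by (simp add: total power_mult_distrib mult.commute)
qed

theorem mainTheorem1:
  fixes l \<rho> :: "nat \<Rightarrow> nat"
  assumes "\<And>n. \<rho> n \<le> n"
    and "(\<lambda>n. real n ^ 2) \<in> o(\<lambda>n. real (l n))"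
    and "\<And>n. l n \<le> n choose 3"
  shows "\<exists>\<epsilon> :: nat \<Rightarrow> real. \<epsilon> \<longlonglongrightarrow> 0 \<and>
    (\<forall>n. \<forall>W. W \<subseteq> verts n \<and> card W = l n \<longrightarrow>
      real (r_bounded \<rho> n W) \<ge>
        real (l n) ^ 2 / real n * (2 - real (\<rho> n) ^ 3 / (6 * real (l n)) + \<epsilon> n))"
proof (intro exI conjI allI impI)
  \<comment> \<open>Multiplied by \<open>l\<^sup>2 / n\<close> this is
    \<open>- 9 * n * l / 2\<close>, half the error term of
    \<open>num_edges_lower_bound\<close>.\<close>
  let ?\<epsilon> = "\<lambda>n. - (9 / 2) * (real n ^ 2 / real (l n))"
  show "?\<epsilon> \<longlonglongrightarrow> 0"
    by (rule tendsto_mult_right_zero[OF smalloD_tendsto[OF assms(2)]])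
  fix n W assume "W \<subseteq> verts n \<and> card W = l n"
  then have W: "W \<subseteq> verts n" and card: "card W = l n"
    by auto
  show "real (r_bounded \<rho> n W) \<ge>
      real (l n) ^ 2 / real n * (2 - real (\<rho> n) ^ 3 / (6 * real (l n)) + ?\<epsilon> n)"
  \<comment> \<open>In the degenerate case the factor \<open>l\<^sup>2 / n\<close> is 0, for
    \<open>n = 0\<close> by the convention \<open>x / 0 = 0\<close>.\<close>
  proof (cases "n = 0 \<or> l n = 0")
    case True
    then show ?thesis by auto
  next
    case False
    then have pos: "real n > 0" "real (l n) > 0"
      by auto
    have "real (9 * l n ^ 2) \<le> real (n * (2 * num_edges n W + 9 * n * l n))"
      using num_edges_lower_bound[OF W] unfolding card of_nat_le_iff .
    then have "9 * real (l n) ^ 2 - 9 * real n ^ 2 * real (l n) \<le> 2 * real n * real (num_edges n W)"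
      by (simp add: algebra_simps power2_eq_square)
    moreover have "real (l n) ^ 2 / real n * (9 / 2 + ?\<epsilon> n)
        = (9 * real (l n) ^ 2 - 9 * real n ^ 2 * real (l n)) / (2 * real n)"
      using pos by (simp add: field_simps power2_eq_square)
    ultimately have edges: "real (l n) ^ 2 / real n * (9 / 2 + ?\<epsilon> n) \<le> real (num_edges n W)"
      using pos by (simp add: divide_le_eq mult_ac)
    \<comment> \<open>The term with \<open>\<rho>\<close> only lowers the target, and 2 is below
      9/2.\<close>
    have "0 \<le> real (\<rho> n) ^ 3 / (6 * real (l n))"
      by simp
    then have "2 - real (\<rho> n) ^ 3 / (6 * real (l n)) + ?\<epsilon> n \<le> 9 / 2 + ?\<epsilon> n"
      by linarith
    then have "real (l n) ^ 2 / real n * (2 - real (\<rho> n) ^ 3 / (6 * real (l n)) + ?\<epsilon> n)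
        \<le> real (l n) ^ 2 / real n * (9 / 2 + ?\<epsilon> n)"
      by (rule mult_left_mono) simp
    also note edges
    also have "real (num_edges n W) \<le> real (r_bounded \<rho> n W)"
      using num_edges_le_r_bounded by simp
    finally show ?thesis .
  qed
qed

end
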